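(* Let $$X=\{(n^2,r,k)\in\mathbb{R}^3 : n\in\mathbb{N}_{\ge1},\ r\in[0,\infty),\ k\in\{1,\ldots,2n+1\}\},$$ $$Y=\{(n^2,r,k)\in\mathbb{R}^3 : n\in\mathbb{N}_{\ge1},\ r\in[0,\infty),\ k\in\{1,\ldots,2n\}\},$$ let $f\colon X\to X$ be the bijective map $f(n^2,r,k)=(n^2,kr,k)$, and let $g\colon Y\to Y$ be the restriction of $f$ to $Y$. Let $\varphi\colon X\to Y$ and $\psi\colon Y\to X$ be given by $\varphi(n^2,r,k)=((n+1)^2,r,k)$ and $\psi(n^2,r,k)=(n^2,r,k)$. Then $\varphi$ and $\psi$ are coarse equivalences, $\varphi\circ f$ is close to $g\circ\varphi$, and $\psi\circ g$ is close to $f\circ\psi$, but $f$ and $g$ are not coarsely conjugate.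
   Context: Subsets of $\mathbb{R}^3$ carry the metric induced by a norm (the choice is irrelevant; e.g. the maximum norm). Let $(X,d_X)$ and $(Y,d_Y)$ be metric spaces. Two maps $a,b$ from a set $S$ to $Y$ are close if $\sup_{x\in S} d_Y(a(x),b(x))<\infty$. A map $\varphi\colon X\to Y$ is controlled if there exists a non-decreasing function $\rho\colon[0,\infty)\to[0,\infty)$ such that $d_Y(\varphi(x),\varphi(x'))\le\rho(d_X(x,x'))$ for all $x,x'\in X$. A controlled map $\varphi\colon X\to Y$ is a coarse equivalence if it admits a coarse inverse, that is, a controlled map $\psi\colon Y\to X$ such that $\varphi\circ\psi$ and $\psi\circ\varphi$ are close to the respective identity maps. Maps $f\colon X\to X$ and $g\colon Y\to Y$ are coarsely conjugate if there exists a coarse equivalence $\Phi\colon X\to Y$ with a coarse inverse $\Psi\colon Y\to X$ such that $\Phi\circ f$ is close to $g\circ\Phi$ and $\Psi\circ g$ is close to $f\circ\Psi$. *)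

theory Defs
  imports "HOL-Analysis.Analysis"
begin

text \<open>A map between metric spaces is a function on the underlying types of which only the values on
  the carrier matter.\<close>

definition close :: "'b metric \<Rightarrow> 's set \<Rightarrow> ('s \<Rightarrow> 'b) \<Rightarrow> ('s \<Rightarrow> 'b) \<Rightarrow> bool" where
  "close B S a b \<longleftrightarrow> bdd_above ((\<lambda>x. mdist B (a x) (b x)) ` S)"

definition controlled :: "'a metric \<Rightarrow> 'b metric \<Rightarrow> ('a \<Rightarrow> 'b) \<Rightarrow> bool" where
  "controlled A B \<phi> \<longleftrightarrow>
     \<phi> \<in> mspace A \<rightarrow> mspace B \<and>
     (\<exists>\<rho> :: real \<Rightarrow> real. \<rho> \<in> {0..} \<rightarrow> {0..} \<and> mono_on {0..} \<rho> \<and>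
        (\<forall>x \<in> mspace A. \<forall>x' \<in> mspace A. mdist B (\<phi> x) (\<phi> x') \<le> \<rho> (mdist A x x')))"

definition coarse_inverse ::
  "'a metric \<Rightarrow> 'b metric \<Rightarrow> ('a \<Rightarrow> 'b) \<Rightarrow> ('b \<Rightarrow> 'a) \<Rightarrow> bool" where
  "coarse_inverse A B \<phi> \<psi> \<longleftrightarrow>
     controlled B A \<psi> \<and> close B (mspace B) (\<phi> \<circ> \<psi>) id \<and> close A (mspace A) (\<psi> \<circ> \<phi>) id"

definition coarse_equivalence :: "'a metric \<Rightarrow> 'b metric \<Rightarrow> ('a \<Rightarrow> 'b) \<Rightarrow> bool" where
  "coarse_equivalence A B \<phi> \<longleftrightarrow> controlled A B \<phi> \<and> (\<exists>\<psi>. coarse_inverse A B \<phi> \<psi>)"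

text \<open>To be used for \<open>f\<close> mapping \<open>mspace A\<close> to itself and \<open>g\<close> mapping \<open>mspace B\<close> to itself; this is
  deliberately not part of the definition, so that the negation of the predicate really says that
  no conjugating pair exists.\<close>

definition coarsely_conjugate ::
  "'a metric \<Rightarrow> 'b metric \<Rightarrow> ('a \<Rightarrow> 'a) \<Rightarrow> ('b \<Rightarrow> 'b) \<Rightarrow> bool" where
  "coarsely_conjugate A B f g \<longleftrightarrow>
     (\<exists>\<Phi> \<Psi>. coarse_equivalence A B \<Phi> \<and> coarse_inverse A B \<Phi> \<Psi> \<and>
        close B (mspace A) (\<Phi> \<circ> f) (g \<circ> \<Phi>) \<and> close A (mspace B) (\<Psi> \<circ> g) (f \<circ> \<Psi>))"

definition is_norm :: "('a::real_vector \<Rightarrow> real) \<Rightarrow> bool" where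
  "is_norm N \<longleftrightarrow>
     (\<forall>x. 0 \<le> N x) \<and> (\<forall>x. N x = 0 \<longleftrightarrow> x = 0) \<and>
     (\<forall>c x. N (c *\<^sub>R x) = \<bar>c\<bar> * N x) \<and> (\<forall>x y. N (x + y) \<le> N x + N y)"

definition norm_metric_on :: "('a::real_vector \<Rightarrow> real) \<Rightarrow> 'a set \<Rightarrow> 'a metric" where
  "norm_metric_on N S = metric (S, \<lambda>x y. N (x - y))"

text \<open>The abstraction function \<open>metric\<close> is meaningful only on pairs forming a metric space, which is
  the case here.\<close>

lemma Metric_space_norm:
  assumes "is_norm N"
  shows "Metric_space S (\<lambda>x y. N (x - y))"
proof
  show "0 \<le> N (x - y)" for x y
    using assms by (simp add: is_norm_def)
  show "N (x - y) = N (y - x)" for x y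
  proof -
    have "N ((-1) *\<^sub>R (y - x)) = \<bar>-1\<bar> * N (y - x)"
      using assms unfolding is_norm_def by blast
    then show ?thesis by simp
  qed
  show "N (x - y) = 0 \<longleftrightarrow> x = y" for x y
    using assms by (simp add: is_norm_def)
  show "N (x - z) \<le> N (x - y) + N (y - z)" for x y z
  proof -
    have "N ((x - y) + (y - z)) \<le> N (x - y) + N (y - z)"
      using assms unfolding is_norm_def by blast
    then show ?thesis by simp
  qed
qed

lemma mspace_norm_metric_on: "is_norm N \<Longrightarrow> mspace (norm_metric_on N S) = S"
  by (simp add: norm_metric_on_def Metric_space.mspace_metric Metric_space_norm)

lemma mdist_norm_metric_on: "is_norm N \<Longrightarrow> mdist (norm_metric_on N S) x y = N (x - y)"
  by (simp add: norm_metric_on_def Metric_space.mdist_metric Metric_space_norm)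

definition X_set :: "(real \<times> real \<times> real) set" where
  "X_set = {((real n)\<^sup>2, r, real k) | (n::nat) (r::real) (k::nat).
              n \<ge> 1 \<and> r \<ge> 0 \<and> k \<in> {1..2 * n + 1}}"

definition Y_set :: "(real \<times> real \<times> real) set" where
  "Y_set = {((real n)\<^sup>2, r, real k) | (n::nat) (r::real) (k::nat).
              n \<ge> 1 \<and> r \<ge> 0 \<and> k \<in> {1..2 * n}}"

end

theory Submission imports Defs begin

text \<open>
  The three claims about \<open>\<phi>\<close> and \<open>\<psi>\<close> are direct: both maps intertwine \<open>f\<close> and \<open>g\<close> exactly, both are
  Lipschitz, and each has a Lipschitz coarse inverse obtained by truncating the third coordinate
  (and, for \<open>\<phi>\<close>, shifting \<open>n\<close> back by one). They are not coarse inverses of each other, since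
  \<open>(n + 1)\<^sup>2 - n\<^sup>2\<close> is unbounded.

  Suppose that \<open>F : X \<rightarrow> Y\<close> and \<open>G : Y \<rightarrow> X\<close> are mutually coarsely inverse and coarsely intertwine \<open>f\<close>
  and \<open>g\<close>. Along a ray \<open>r \<mapsto> (n\<^sup>2, r, k)\<close> write \<open>F (n\<^sup>2, r, k) = (m(r)\<^sup>2, s(r), \<kappa>(r))\<close>. The increments of \<open>s\<close>
  are bounded, \<open>s\<close> grows at least linearly because \<open>G\<close> almost inverts \<open>F\<close>, and
  \<open>s(k r) = \<kappa>(r) s(r) + O(1)\<close>. Comparing \<open>r\<close> with \<open>r + 1\<close> gives \<open>(\<kappa>(r + 1) - \<kappa>(r)) s(r) = O(1)\<close>, so \<open>\<kappa>\<close> is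
  eventually a constant \<open>q\<close>; then \<open>s(k\<^sup>j r)\<close> grows like \<open>q\<^sup>j\<close> as well as like \<open>k\<^sup>j\<close>, whence \<open>q = k\<close>
  (lemma \<open>asymptotic_multiplier\<close>). So \<open>F\<close> and \<open>G\<close> eventually preserve the third coordinate on every ray
  (lemma \<open>eventually_same_height\<close>).

  Take \<open>n\<close> large and \<open>k = 2 n + 1\<close>. The image of this ray under \<open>F\<close> ends up in a single component
  \<open>m\<close> of \<open>Y\<close>, and a point of height \<open>2 n + 1\<close> fits there only if \<open>m > n\<close>. Likewise \<open>G\<close> maps far points
  \<open>(m\<^sup>2, s, 2 m)\<close> to points of height \<open>2 m\<close>, hence into components \<open>\<nu>\<close> with \<open>\<nu> \<ge> m > n\<close>. But the
  component \<open>n\<close> is isolated at the scale of the constants, so that \<open>G\<close> maps \<open>F (n\<^sup>2, r, 2 n + 1)\<close>, and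
  then every point reached from it inside component \<open>m\<close> by unit steps, into component \<open>n\<close>: a
  contradiction (lemma \<open>no_coarse_conjugacy_strips\<close>).
\<close>

section \<open>Unions of half-infinite strips\<close>

text \<open>A common notation for the two spaces: \<open>strips 1\<close> is \<open>X_set\<close> and \<open>strips 0\<close> is \<open>Y_set\<close>. The strip
  over \<open>n\<^sup>2\<close> is called component \<open>n\<close> below, and the third coordinate of a point its height.\<close>

definition strips :: "nat \<Rightarrow> (real \<times> real \<times> real) set" where
  "strips e = {((real n)\<^sup>2, r, real k) | (n::nat) (r::real) (k::nat).
                 n \<ge> 1 \<and> r \<ge> 0 \<and> k \<in> {1..2 * n + e}}"

lemma X_set_eq_strips: "X_set = strips 1" and Y_set_eq_strips: "Y_set = strips 0"
  by (simp_all add: X_set_def Y_set_def strips_def)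

lemma stripsI:
  "n \<ge> 1 \<Longrightarrow> r \<ge> 0 \<Longrightarrow> k \<ge> 1 \<Longrightarrow> k \<le> 2 * n + e \<Longrightarrow> ((real n)\<^sup>2, r, real k) \<in> strips e"
  by (auto simp: strips_def)

lemma stripsE:
  assumes "x \<in> strips e"
  obtains n r k where "x = ((real n)\<^sup>2, r, real k)" "n \<ge> 1" "r \<ge> 0" "k \<ge> 1" "k \<le> 2 * n + e"
  using assms by (auto simp: strips_def)

lemma abs_coord_le_dist:
  fixes x y :: "real \<times> real \<times> real"
  shows "\<bar>fst x - fst y\<bar> \<le> dist x y"
    and "\<bar>fst (snd x) - fst (snd y)\<bar> \<le> dist x y"
    and "\<bar>snd (snd x) - snd (snd y)\<bar> \<le> dist x y"
  using dist_fst_le[of x y] dist_snd_le[of x y]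
    dist_fst_le[of "snd x" "snd y"] dist_snd_le[of "snd x" "snd y"]
  by (simp_all add: dist_real_def)

lemma dist_le_sum_coord:
  fixes a b c a' b' c' :: real
  shows "dist (a, b, c) (a', b', c') \<le> \<bar>a - a'\<bar> + \<bar>b - b'\<bar> + \<bar>c - c'\<bar>"
proof -
  have "dist (a, b, c) (a', b', c') \<le> dist a a' + dist (b, c) (b', c')"
    unfolding dist_Pair_Pair by (rule sqrt_sum_squares_le_sum) auto
  also have "dist (b, c) (b', c') \<le> dist b b' + dist c c'"
    unfolding dist_Pair_Pair by (rule sqrt_sum_squares_le_sum) auto
  finally show ?thesis by (simp add: dist_real_def)
qed

section \<open>Controlled and close maps for a norm metric\<close>

lemma norm_equivalence:
  fixes N :: "'a::euclidean_space \<Rightarrow> real"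
  assumes N: "is_norm N"
  obtains c where "c \<ge> 1" "\<And>x. norm x \<le> c * N x" "\<And>x. N x \<le> c * norm x"
proof -
  have nonneg: "0 \<le> N x" and zero: "N x = 0 \<longleftrightarrow> x = 0"
    and scale: "N (a *\<^sub>R x) = \<bar>a\<bar> * N x" and tri: "N (x + y) \<le> N x + N y" for a x y
    using N by (auto simp: is_norm_def)
  define K where "K = (\<Sum>b\<in>Basis. N b)"
  have N_sum: "N (sum h I) \<le> (\<Sum>i\<in>I. N (h i))" if "finite I" for h :: "'a \<Rightarrow> 'a" and I
    using that
  proof induction
    case empty
    then show ?case using zero[of 0] by simp
  next
    case (insert i I)
    then show ?case using tri[of "h i" "sum h I"] by simp
  qed
  have upper: "N x \<le> K * norm x" for x
  proof -
    have "N x = N (\<Sum>b\<in>Basis. (x \<bullet> b) *\<^sub>R b)" by (simp add: euclidean_representation)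
    also have "\<dots> \<le> (\<Sum>b\<in>Basis. \<bar>x \<bullet> b\<bar> * N b)"
      using N_sum[of Basis "\<lambda>b. (x \<bullet> b) *\<^sub>R b"] by (simp add: scale)
    also have "\<dots> \<le> (\<Sum>b\<in>Basis. norm x * N b)"
      by (intro sum_mono mult_right_mono Basis_le_norm nonneg)
    finally show ?thesis by (simp add: K_def sum_distrib_left mult.commute)
  qed
  have "K-lipschitz_on UNIV N"
  proof (rule lipschitz_onI)
    show "0 \<le> K" unfolding K_def by (intro sum_nonneg nonneg)
    have "N x - N y \<le> K * dist x y" for x y
      using tri[of "x - y" y] upper[of "x - y"] by (simp add: dist_norm)
    from this show "dist (N x) (N y) \<le> K * dist x y" for x y
      by (smt (verit) dist_commute dist_real_def)
  qed
  then have "continuous_on (sphere 0 1) N"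
    using lipschitz_on_continuous_on continuous_on_subset by blast
  moreover have "compact (sphere (0::'a) 1)" "sphere (0::'a) 1 \<noteq> {}" by auto
  ultimately obtain z where z: "z \<in> sphere 0 1" "\<And>y. y \<in> sphere 0 1 \<Longrightarrow> N z \<le> N y"
    using continuous_attains_inf[of "sphere 0 1" N] by blast
  have pos: "N z > 0"
    using z(1) nonneg[of z] zero[of z] by (metis less_eq_real_def norm_zero mem_sphere_0 zero_neq_one)
  have lower: "norm x \<le> N x / N z" for x
  proof (cases "x = 0")
    case False
    have "N z \<le> N ((1 / norm x) *\<^sub>R x)" using False by (intro z(2)) simp
    then have "N z \<le> N x / norm x" by (simp add: scale)
    then show ?thesis using pos False by (simp add: field_simps)
  qed (simp add: nonneg pos order_less_imp_le)
  define c where "c = max 1 (max K (1 / N z))"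
  show ?thesis
  proof
    show "c \<ge> 1" by (simp add: c_def)
    show "norm x \<le> c * N x" for x
    proof -
      have "1 / N z * N x \<le> c * N x" by (intro mult_right_mono nonneg) (simp add: c_def)
      then show ?thesis using lower[of x] by simp
    qed
    show "N x \<le> c * norm x" for x
    proof -
      have "K * norm x \<le> c * norm x" by (intro mult_right_mono) (auto simp: c_def)
      then show ?thesis using upper[of x] by simp
    qed
  qed
qed

text \<open>Since all norms are equivalent, the coarse notions can be expressed with the Euclidean
  distance \<open>dist\<close>, whatever the norm.\<close>

lemma close_norm_metric_iff:
  fixes N :: "'a::euclidean_space \<Rightarrow> real"
  assumes N: "is_norm N"
  shows "close (norm_metric_on N B) S u v \<longleftrightarrow> (\<exists>C. \<forall>x\<in>S. dist (u x) (v x) \<le> C)"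
proof -
  obtain c where c: "c \<ge> 1" "\<And>x. norm x \<le> c * N x" "\<And>x. N x \<le> c * norm x"
    using norm_equivalence[OF N] by blast
  have "close (norm_metric_on N B) S u v \<longleftrightarrow> (\<exists>C. \<forall>x\<in>S. N (u x - v x) \<le> C)"
    by (auto simp: close_def bdd_above_def mdist_norm_metric_on[OF N])
  also have "\<dots> \<longleftrightarrow> (\<exists>C. \<forall>x\<in>S. dist (u x) (v x) \<le> C)"
  proof (intro iffI; elim exE)
    fix C assume C: "\<forall>x\<in>S. N (u x - v x) \<le> C"
    have "dist (u x) (v x) \<le> c * C" if "x \<in> S" for x
    proof -
      have "c * N (u x - v x) \<le> c * C" using C that c(1) by (intro mult_left_mono) auto
      then show ?thesis using c(2)[of "u x - v x"] by (simp add: dist_norm)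
    qed
    then show "\<exists>C. \<forall>x\<in>S. dist (u x) (v x) \<le> C" by blast
  next
    fix C assume C: "\<forall>x\<in>S. dist (u x) (v x) \<le> C"
    have "N (u x - v x) \<le> c * C" if "x \<in> S" for x
    proof -
      have "c * dist (u x) (v x) \<le> c * C" using C that c(1) by (intro mult_left_mono) auto
      then show ?thesis using c(3)[of "u x - v x"] by (simp add: dist_norm)
    qed
    then show "\<exists>C. \<forall>x\<in>S. N (u x - v x) \<le> C" by blast
  qed
  finally show ?thesis .
qed

text \<open>Controlledness for the Euclidean distance without a monotone control function: points at
  distance at most \<open>t\<close> have images at distance at most some \<open>C\<close> depending only on \<open>t\<close>.\<close>

definition bornologous_on :: "'a::metric_space set \<Rightarrow> ('a \<Rightarrow> 'b::metric_space) \<Rightarrow> bool" where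
  "bornologous_on A F \<longleftrightarrow>
     (\<forall>t. \<exists>C. \<forall>x\<in>A. \<forall>x'\<in>A. dist x x' \<le> t \<longrightarrow> dist (F x) (F x') \<le> C)"

lemma bornologous_onE:
  assumes "bornologous_on A F"
  obtains C where "C \<ge> 1"
    "\<And>x x'. x \<in> A \<Longrightarrow> x' \<in> A \<Longrightarrow> dist x x' \<le> t \<Longrightarrow> dist (F x) (F x') \<le> C"
proof -
  obtain C where "\<forall>x\<in>A. \<forall>x'\<in>A. dist x x' \<le> t \<longrightarrow> dist (F x) (F x') \<le> C"
    using assms unfolding bornologous_on_def by blast
  then have "\<And>x x'. x \<in> A \<Longrightarrow> x' \<in> A \<Longrightarrow> dist x x' \<le> t \<Longrightarrow> dist (F x) (F x') \<le> max 1 C"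
    by fastforce
  then show ?thesis using that[of "max 1 C"] by simp
qed

lemma controlled_norm_metricD:
  fixes N :: "'a::euclidean_space \<Rightarrow> real"
  assumes N: "is_norm N" and F: "controlled (norm_metric_on N A) (norm_metric_on N B) F"
  shows "F \<in> A \<rightarrow> B" and "bornologous_on A F"
proof -
  obtain c where c: "c \<ge> 1" "\<And>x. norm x \<le> c * N x" "\<And>x. N x \<le> c * norm x"
    using norm_equivalence[OF N] by blast
  from F obtain \<rho> where FAB: "F \<in> A \<rightarrow> B" and mono: "mono_on {0..} \<rho>"
    and \<rho>: "\<And>x x'. x \<in> A \<Longrightarrow> x' \<in> A \<Longrightarrow> N (F x - F x') \<le> \<rho> (N (x - x'))"
    unfolding controlled_def mspace_norm_metric_on[OF N] mdist_norm_metric_on[OF N] by blast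
  show "F \<in> A \<rightarrow> B" by (fact FAB)
  have "dist (F x) (F x') \<le> c * \<rho> (c * t)"
    if x: "x \<in> A" "x' \<in> A" and d: "dist x x' \<le> t" for x x' t
  proof -
    have "c * dist x x' \<le> c * t" using d c(1) by (intro mult_left_mono) auto
    then have "N (x - x') \<le> c * t" using c(3)[of "x - x'"] by (simp add: dist_norm)
    moreover have "0 \<le> N (x - x')" using N by (simp add: is_norm_def)
    ultimately have "\<rho> (N (x - x')) \<le> \<rho> (c * t)"
      using mono by (auto intro: mono_onD)
    then have "N (F x - F x') \<le> \<rho> (c * t)" using \<rho>[OF x] by linarith
    then have "c * N (F x - F x') \<le> c * \<rho> (c * t)" using c(1) by (intro mult_left_mono) auto
    then show ?thesis using c(2)[of "F x - F x'"] by (simp add: dist_norm)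
  qed
  then show "bornologous_on A F" unfolding bornologous_on_def by blast
qed

lemma lipschitz_imp_controlled_norm_metric:
  fixes N :: "'a::euclidean_space \<Rightarrow> real"
  assumes N: "is_norm N" and FAB: "F \<in> A \<rightarrow> B" and L: "L-lipschitz_on A F"
  shows "controlled (norm_metric_on N A) (norm_metric_on N B) F"
proof -
  obtain c where c: "c \<ge> 1" "\<And>x. norm x \<le> c * N x" "\<And>x. N x \<le> c * norm x"
    using norm_equivalence[OF N] by blast
  have L0: "L \<ge> 0" using L by (rule lipschitz_on_nonneg)
  have "N (F x - F x') \<le> (c * L * c) * N (x - x')" if "x \<in> A" "x' \<in> A" for x x'
  proof -
    have "N (F x - F x') \<le> c * dist (F x) (F x')" using c(3) by (simp add: dist_norm)
    also have "\<dots> \<le> c * (L * dist x x')"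
      using c(1) lipschitz_onD[OF L that] by (intro mult_left_mono) auto
    also have "\<dots> \<le> c * (L * (c * N (x - x')))"
      using c(1) c(2)[of "x - x'"] L0 by (intro mult_left_mono) (auto simp: dist_norm)
    finally show ?thesis by (simp add: mult.assoc)
  qed
  moreover have "(\<lambda>t. (c * L * c) * t) \<in> {0..} \<rightarrow> {0..}" using c(1) L0 by auto
  moreover have "mono_on {0..} (\<lambda>t. (c * L * c) * t)"
    using c(1) L0 by (intro mono_onI mult_left_mono) auto
  ultimately show ?thesis
    unfolding controlled_def mspace_norm_metric_on[OF N] mdist_norm_metric_on[OF N]
    using FAB by blast
qed

section \<open>Controlled maps between strips\<close>

text \<open>The map sending \<open>(n\<^sup>2, r, k)\<close> to \<open>(\<mu>(n)\<^sup>2, r, \<kappa>(n, k))\<close>; its values at triples not of this form are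
  irrelevant. The coarse inverses of \<open>\<phi>\<close> and \<open>\<psi>\<close> are such maps.\<close>

definition strip_map ::
  "(nat \<Rightarrow> nat) \<Rightarrow> (nat \<Rightarrow> nat \<Rightarrow> nat) \<Rightarrow> real \<times> real \<times> real \<Rightarrow> real \<times> real \<times> real" where
  "strip_map \<mu> \<kappa> = (\<lambda>(p, r, c). let n = nat \<lfloor>sqrt p\<rfloor> in
     ((real (\<mu> n))\<^sup>2, r, real (\<kappa> n (nat \<lfloor>c\<rfloor>))))"

lemma strip_map_simp [simp]:
  "strip_map \<mu> \<kappa> ((real n)\<^sup>2, r, real k) = ((real (\<mu> n))\<^sup>2, r, real (\<kappa> n k))"
  by (simp add: strip_map_def)

text \<open>The bound \<open>\<mu>(n) \<le> n + 1\<close> makes \<open>\<mu>(n)\<^sup>2\<close> a Lipschitz function of \<open>n\<^sup>2\<close>, via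
  \<open>n\<^sup>2 - n'\<^sup>2 = (n - n') (n + n')\<close>. A change of the component may change the height by
  \<open>2 \<bar>n - n'\<bar> \<le> \<bar>n\<^sup>2 - n'\<^sup>2\<bar>\<close>.\<close>

lemma controlled_strips:
  fixes N :: "real \<times> real \<times> real \<Rightarrow> real" and \<mu> :: "nat \<Rightarrow> nat" and \<kappa> :: "nat \<Rightarrow> nat \<Rightarrow> nat"
  assumes N: "is_norm N"
    and F: "\<And>n r k. n \<ge> 1 \<Longrightarrow> r \<ge> 0 \<Longrightarrow> k \<ge> 1 \<Longrightarrow> k \<le> 2 * n + a \<Longrightarrow>
              F ((real n)\<^sup>2, r, real k) = ((real (\<mu> n))\<^sup>2, r, real (\<kappa> n k))"
    and \<mu>: "\<And>n. n \<ge> 1 \<Longrightarrow> 1 \<le> \<mu> n \<and> \<mu> n \<le> n + 1"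
    and \<mu>_lip: "\<And>n n'. \<bar>real (\<mu> n) - real (\<mu> n')\<bar> \<le> \<bar>real n - real n'\<bar>"
    and \<kappa>: "\<And>n k. n \<ge> 1 \<Longrightarrow> k \<ge> 1 \<Longrightarrow> k \<le> 2 * n + a \<Longrightarrow> 1 \<le> \<kappa> n k \<and> \<kappa> n k \<le> 2 * \<mu> n + b"
    and \<kappa>_lip: "\<And>n n' k k'.
      \<bar>real (\<kappa> n k) - real (\<kappa> n' k')\<bar> \<le> \<bar>real k - real k'\<bar> + 2 * \<bar>real n - real n'\<bar>"
  shows "controlled (norm_metric_on N (strips a)) (norm_metric_on N (strips b)) F"
proof (rule lipschitz_imp_controlled_norm_metric[OF N])
  show "F \<in> strips a \<rightarrow> strips b"
  proof
    fix x assume "x \<in> strips a"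
    then show "F x \<in> strips b"
      by (elim stripsE) (use F \<mu> \<kappa> in \<open>auto intro!: stripsI\<close>)
  qed
  show "5-lipschitz_on (strips a) F"
  proof (rule lipschitz_onI)
    fix x x' assume x: "x \<in> strips a" and x': "x' \<in> strips a"
    obtain n r k where 1: "x = ((real n)\<^sup>2, r, real k)" "n \<ge> 1" "r \<ge> 0" "k \<ge> 1" "k \<le> 2 * n + a"
      using x by (rule stripsE)
    obtain n' r' k' where 2: "x' = ((real n')\<^sup>2, r', real k')" "n' \<ge> 1" "r' \<ge> 0" "k' \<ge> 1"
      "k' \<le> 2 * n' + a"
      using x' by (rule stripsE)
    let ?d = "\<bar>real n - real n'\<bar>" and ?D = "\<bar>(real n)\<^sup>2 - (real n')\<^sup>2\<bar>"
    have D: "?D = ?d * (real n + real n')"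
      by (simp add: power2_eq_square square_diff_square_factored abs_mult mult.commute)
    have "?d * 2 \<le> ?d * (real n + real n')" using 1(2) 2(2) by (intro mult_left_mono) auto
    then have d: "2 * ?d \<le> ?D" using D by simp
    have "\<bar>(real (\<mu> n))\<^sup>2 - (real (\<mu> n'))\<^sup>2\<bar>
        = \<bar>real (\<mu> n) - real (\<mu> n')\<bar> * (real (\<mu> n) + real (\<mu> n'))"
      by (simp add: power2_eq_square square_diff_square_factored abs_mult mult.commute)
    also have "\<dots> \<le> ?d * (2 * (real n + real n'))"
      using \<mu>[OF 1(2)] \<mu>[OF 2(2)] 1(2) 2(2) by (intro mult_mono \<mu>_lip) auto
    finally have m: "\<bar>(real (\<mu> n))\<^sup>2 - (real (\<mu> n'))\<^sup>2\<bar> \<le> 2 * ?D" using D by (simp add: algebra_simps)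
    have "dist (F x) (F x') \<le> \<bar>(real (\<mu> n))\<^sup>2 - (real (\<mu> n'))\<^sup>2\<bar> + \<bar>r - r'\<bar>
        + \<bar>real (\<kappa> n k) - real (\<kappa> n' k')\<bar>"
      using 1 2 by (simp add: F dist_le_sum_coord)
    also have "\<dots> \<le> 3 * ?D + \<bar>r - r'\<bar> + \<bar>real k - real k'\<bar>"
      using m d \<kappa>_lip[of n k n' k'] by linarith
    also have "\<dots> \<le> 3 * dist x x' + dist x x' + dist x x'"
      using abs_coord_le_dist[of x x'] unfolding 1(1) 2(1) fst_conv snd_conv
      by (intro add_mono mult_left_mono) auto
    finally show "dist (F x) (F x') \<le> 5 * dist x x'" by simp
  qed simp
qed

section \<open>Rigidity of multipliers\<close>

lemma exponential_not_dominated: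
  fixes a b u v w :: real
  assumes "b \<ge> 1" "a > b" "u > 0" "v \<ge> 0"
  shows "\<exists>j. a ^ j * u > v + w * b ^ j"
proof -
  obtain j where j: "(v + w) / u < (a / b) ^ j"
    using real_arch_pow[of "a / b" "(v + w) / u"] assms by auto
  have bj: "b ^ j \<ge> 1" using assms by simp
  have "v + w * b ^ j \<le> (v + w) * b ^ j"
    using bj assms mult_left_mono[of 1 "b ^ j" v] by (simp add: algebra_simps)
  also have "\<dots> < ((a / b) ^ j * u) * b ^ j"
    using j assms bj by (intro mult_strict_right_mono) (auto simp: field_simps)
  also have "\<dots> = a ^ j * u" using assms by (simp add: power_divide)
  finally show ?thesis by blast
qed

lemma dist_chain_le:
  fixes h :: "nat \<Rightarrow> 'a::metric_space"
  assumes "\<And>r. dist (h (Suc r)) (h r) \<le> C"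
  shows "dist (h (r + i)) (h r) \<le> C * real i"
proof (induction i)
  case (Suc i)
  then show ?case
    using assms[of "r + i"] dist_triangle[of "h (Suc (r + i))" "h r" "h (r + i)"]
    by (simp add: algebra_simps)
qed simp

text \<open>A sequence of linear growth and bounded increments that turns multiplication of the index by
  \<open>k\<close> into multiplication by the bounded integers \<open>\<kappa>(r)\<close>, up to a bounded error, has \<open>\<kappa>(r) = k\<close> for
  large \<open>r\<close>.\<close>

lemma asymptotic_multiplier:
  fixes s :: "nat \<Rightarrow> real" and \<kappa> :: "nat \<Rightarrow> nat" and k :: nat
  assumes step: "\<And>r. \<bar>s (Suc r) - s r\<bar> \<le> C"
    and lower: "\<And>r. real r \<le> \<alpha> + \<beta> * s r" and \<beta>: "\<beta> > 0"
    and mult: "\<And>r. \<bar>s (k * r) - real (\<kappa> r) * s r\<bar> \<le> C"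
    and \<kappa>: "\<And>r. 1 \<le> \<kappa> r" "\<And>r. \<kappa> r \<le> K" and k: "k \<ge> 1"
  shows "\<exists>R. \<forall>r\<ge>R. \<kappa> r = k"
proof -
  have C: "C \<ge> 0" using step[of 0] by linarith
  have s_large: "\<exists>R. \<forall>r\<ge>R. s r \<ge> S" for S
  proof -
    obtain R :: nat where R: "\<alpha> + \<beta> * S \<le> real R" using real_arch_simple by blast
    have "s r \<ge> S" if "r \<ge> R" for r
    proof -
      have "\<beta> * S \<le> \<beta> * s r" using R lower[of r] that by linarith
      then show ?thesis using \<beta> by simp
    qed
    then show ?thesis by blast
  qed
  have s_diff: "\<bar>s (r + i) - s r\<bar> \<le> C * real i" for r i
    using dist_chain_le[of s C r i] step by (simp add: dist_real_def)
  define E where "E = real k * C + 2 * C + real K * C"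
  have jump: "\<bar>real (\<kappa> (Suc r)) - real (\<kappa> r)\<bar> * s r \<le> E" if s0: "s r \<ge> 0" for r
  proof -
    have 1: "\<bar>s (k * Suc r) - s (k * r)\<bar> \<le> real k * C"
      using s_diff[of "k * r" k] by (simp add: algebra_simps)
    have "real (\<kappa> (Suc r)) * \<bar>s (Suc r) - s r\<bar> \<le> real K * C"
      using \<kappa>(2)[of "Suc r"] step[of r] by (intro mult_mono) auto
    then have 2: "\<bar>real (\<kappa> (Suc r)) * s (Suc r) - real (\<kappa> (Suc r)) * s r\<bar> \<le> real K * C"
      by (simp add: abs_mult flip: right_diff_distrib)
    have "\<bar>real (\<kappa> (Suc r)) * s r - real (\<kappa> r) * s r\<bar> \<le> E"
      using 1 2 mult[of r] mult[of "Suc r"] unfolding E_def by linarith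
    then show ?thesis using s0 by (simp add: abs_mult flip: left_diff_distrib)
  qed
  obtain R where R: "\<And>r. r \<ge> R \<Longrightarrow> s r \<ge> max (E + 1) (4 * C + 1)"
    using s_large by blast
  have E: "E \<ge> 0" using C by (simp add: E_def)
  \<comment> \<open>\<open>\<kappa>\<close> takes integer values, so a change of \<open>\<kappa>\<close> violates \<open>jump\<close> as soon as \<open>s r > E\<close>.\<close>
  have const_step: "\<kappa> (Suc r) = \<kappa> r" if "r \<ge> R" for r
  proof (rule ccontr)
    assume ne: "\<kappa> (Suc r) \<noteq> \<kappa> r"
    have s: "s r \<ge> E + 1" using R[OF that] by simp
    have "1 \<le> \<bar>real (\<kappa> (Suc r)) - real (\<kappa> r)\<bar>" using ne by linarith
    then have "1 * s r \<le> \<bar>real (\<kappa> (Suc r)) - real (\<kappa> r)\<bar> * s r"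
      using s E by (intro mult_right_mono) auto
    then show False using jump[of r] s E by linarith
  qed
  define q where "q = \<kappa> (Suc R)"
  have const: "\<kappa> r = q" if "r \<ge> R" for r
    using that
  proof (induction r rule: dec_induct)
    case base
    show ?case using const_step[of R] by (simp add: q_def)
  next
    case (step r)
    then show ?case using const_step[of r] by simp
  qed
  have q1: "q \<ge> 1" using \<kappa>(1) by (simp add: q_def)
  define R' where "R' = Suc R"
  define t where "t j = s (k ^ j * R')" for j
  have ge: "k ^ j * R' \<ge> R" for j
  proof -
    have "1 * R' \<le> k ^ j * R'" using k by (intro mult_right_mono) auto
    then show ?thesis by (simp add: R'_def)
  qed
  have t_ge: "t j \<ge> 4 * C + 1" for j using R[OF ge[of j]] by (simp add: t_def)
  \<comment> \<open>Where \<open>s \<ge> 4 C\<close>, the additive error \<open>C\<close> changes the multiplier by at most \<open>1/4\<close>, which is too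
    little to bridge the gap between the integers \<open>q\<close> and \<open>k\<close>.\<close>
  have t_step: "\<bar>t (Suc j) - real q * t j\<bar> \<le> t j / 4" for j
    using mult[of "k ^ j * R'"] const[OF ge[of j]] t_ge[of j] by (simp add: t_def mult.assoc)
  have t_upper: "t j \<le> (real q + 1/4) ^ j * t 0" for j
  proof (induction j)
    case (Suc j)
    have "t (Suc j) \<le> real q * t j + t j / 4" using t_step[of j] by linarith
    then have "t (Suc j) \<le> (real q + 1/4) * t j" by (simp add: algebra_simps)
    also have "\<dots> \<le> (real q + 1/4) * ((real q + 1/4) ^ j * t 0)"
      using Suc by (intro mult_left_mono) auto
    finally show ?case by (simp add: mult.assoc)
  qed simp
  have t_lower: "(real q - 1/4) ^ j * t 0 \<le> t j" for j
  proof (induction j)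
    case (Suc j)
    have "(real q - 1/4) * ((real q - 1/4) ^ j * t 0) \<le> (real q - 1/4) * t j"
      using Suc q1 by (intro mult_left_mono) auto
    also have "\<dots> = real q * t j - t j / 4" by (simp add: algebra_simps)
    also have "\<dots> \<le> t (Suc j)" using t_step[of j] by linarith
    finally show ?case by (simp add: mult.assoc)
  qed simp
  have t0: "t 0 > 0" using t_ge[of 0] C by linarith
  have "\<not> q < k"
  proof
    assume "q < k"
    then have "real k > real q + 1/4" by linarith
    then obtain j where j: "real k ^ j * real R' > \<bar>\<alpha>\<bar> + (\<beta> * t 0) * (real q + 1/4) ^ j"
      using exponential_not_dominated[of "real q + 1/4" "real k" "real R'" "\<bar>\<alpha>\<bar>" "\<beta> * t 0"] q1
      by (auto simp: R'_def)
    have "real k ^ j * real R' \<le> \<alpha> + \<beta> * t j"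
      using lower[of "k ^ j * R'"] by (simp add: t_def)
    also have "\<dots> \<le> \<bar>\<alpha>\<bar> + \<beta> * ((real q + 1/4) ^ j * t 0)"
      using \<beta> t_upper by (intro add_mono mult_left_mono) auto
    finally show False using j by (simp add: mult_ac)
  qed
  moreover have "\<not> k < q"
  proof
    assume "k < q"
    then have "real k < real q - 1/4" by linarith
    then obtain j where j: "(real q - 1/4) ^ j * t 0 > \<bar>s 0\<bar> + (C * real R') * real k ^ j"
      using exponential_not_dominated[of "real k" "real q - 1/4" "t 0" "\<bar>s 0\<bar>" "C * real R'"] k t0
      by auto
    have "t j \<le> \<bar>s 0\<bar> + C * real (k ^ j * R')"
      using s_diff[of 0 "k ^ j * R'"] unfolding t_def by (simp del: of_nat_mult of_nat_power)
    then show False using j t_lower[of j] by (simp add: mult_ac)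
  qed
  ultimately have "q = k" by simp
  then show ?thesis using const by blast
qed


section \<open>Coarse conjugacies between strips\<close>

text \<open>The formula that defines \<open>f\<close> and \<open>g\<close>, on all triples.\<close>

definition fibre_scaling :: "real \<times> real \<times> real \<Rightarrow> real \<times> real \<times> real" where
  "fibre_scaling = (\<lambda>(p, r, k). (p, k * r, k))"

lemma fibre_scaling_simp [simp]: "fibre_scaling (p, r, k) = (p, k * r, k)"
  by (simp add: fibre_scaling_def)

text \<open>Distinct squares \<open>m\<^sup>2\<close> and \<open>n\<^sup>2\<close> differ by at least \<open>m + n\<close>, so no other component lies within
  distance \<open>C < n\<close> of component \<open>n\<close>.\<close>

lemma strip_isolated:
  assumes x: "x \<in> strips e" and near: "\<bar>fst x - (real n)\<^sup>2\<bar> \<le> C" and C: "C < real n"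
  shows "fst x = (real n)\<^sup>2"
proof -
  obtain m r k where m: "x = ((real m)\<^sup>2, r, real k)" using x by (rule stripsE)
  have "m = n"
  proof (rule ccontr)
    assume "m \<noteq> n"
    then have "1 \<le> \<bar>real m - real n\<bar>" by linarith
    then have "real m + real n \<le> \<bar>real m - real n\<bar> * (real m + real n)"
      using mult_right_mono[of 1 "\<bar>real m - real n\<bar>" "real m + real n"] by simp
    also have "\<dots> = \<bar>fst x - (real n)\<^sup>2\<bar>"
      by (simp add: m power2_eq_square square_diff_square_factored abs_mult mult.commute)
    finally show False using near C by linarith
  qed
  then show ?thesis by (simp add: m)
qed

text \<open>The hypotheses make \<open>F\<close> a coarse embedding that coarsely commutes with the scaling. The
  conclusion also records that the second coordinate of the image tends to infinity and that the
  height \<open>k\<close> occurs in the component that contains the image.\<close>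

lemma eventually_same_height:
  assumes F: "F \<in> strips a \<rightarrow> strips b" "bornologous_on (strips a) F"
    and G: "G \<in> strips b \<rightarrow> strips a" "bornologous_on (strips b) G"
    and GF: "\<forall>x\<in>strips a. dist (G (F x)) x \<le> C1"
    and conj: "\<forall>x\<in>strips a. dist (F (fibre_scaling x)) (fibre_scaling (F x)) \<le> C2"
    and nk: "n \<ge> 1" "k \<ge> 1" "k \<le> 2 * n + a"
  shows "\<exists>R. \<forall>r\<ge>R. \<exists>m s. F ((real n)\<^sup>2, real r, real k) = ((real m)\<^sup>2, s, real k) \<and>
           m \<ge> 1 \<and> s \<ge> S \<and> s \<ge> 0 \<and> k \<le> 2 * m + b"
proof -
  define x where "x r = ((real n)\<^sup>2, real r, real k)" for r :: nat
  have x: "x r \<in> strips a" for r using nk by (auto simp: x_def intro: stripsI)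
  have "\<forall>r. \<exists>m s l. F (x r) = ((real m)\<^sup>2, s, real l) \<and> m \<ge> 1 \<and> s \<ge> 0 \<and> l \<ge> 1 \<and> l \<le> 2 * m + b"
  proof
    fix r
    have "F (x r) \<in> strips b" using F(1) x by blast
    then show "\<exists>m s l. F (x r) = ((real m)\<^sup>2, s, real l) \<and> m \<ge> 1 \<and> s \<ge> 0 \<and> l \<ge> 1 \<and> l \<le> 2 * m + b"
      by (elim stripsE) blast
  qed
  then obtain m s \<kappa> where Fx: "\<And>r. F (x r) = ((real (m r))\<^sup>2, s r, real (\<kappa> r))"
    and m: "\<And>r. m r \<ge> (1::nat)" and s: "\<And>r. s r \<ge> 0"
    and \<kappa>: "\<And>r. \<kappa> r \<ge> 1" "\<And>r. \<kappa> r \<le> 2 * m r + b"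
    by metis
  obtain CF where CF: "CF \<ge> 1"
    "\<And>x x'. x \<in> strips a \<Longrightarrow> x' \<in> strips a \<Longrightarrow> dist x x' \<le> 1 \<Longrightarrow> dist (F x) (F x') \<le> CF"
    using F(2) by (rule bornologous_onE[where t = 1]) blast
  have Fstep: "dist (F (x (Suc r))) (F (x r)) \<le> CF" for r
    by (intro CF x) (simp add: x_def dist_Pair_Pair dist_real_def)

  obtain B :: nat where B: "B \<ge> CF" "B \<ge> m 0"
    using real_arch_simple[of "max CF (real (m 0))"] by auto
  \<comment> \<open>A component beyond \<open>B\<close> is isolated at scale \<open>CF\<close>, so the image cannot enter it from below.\<close>
  have m_le: "m r \<le> B" for r
  proof (induction r)
    case 0
    then show ?case using B by simp
  next
    case (Suc r)
    show ?case
    proof (rule ccontr)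
      assume gt: "\<not> m (Suc r) \<le> B"
      have "\<bar>fst (F (x r)) - (real (m (Suc r)))\<^sup>2\<bar> \<le> CF"
        using abs_coord_le_dist(1)[of "F (x r)" "F (x (Suc r))"] Fstep[of r]
        by (simp add: Fx dist_commute)
      then have "fst (F (x r)) = (real (m (Suc r)))\<^sup>2"
        by (rule strip_isolated[rotated]) (use F(1) x B(1) gt in auto)
      then have "m r = m (Suc r)" by (simp add: Fx)
      then show False using Suc gt by simp
    qed
  qed
  have \<kappa>_le: "\<kappa> r \<le> 2 * B + b" for r using \<kappa>(2)[of r] m_le[of r] by linarith

  \<comment> \<open>The image of the ray stays within \<open>D\<close> of the bottom ray \<open>(1, i, 1)\<close>, along which \<open>G\<close> moves at
    bounded speed. As \<open>G\<close> almost inverts \<open>F\<close>, this bounds \<open>r\<close> by a linear function of \<open>s r\<close>.\<close>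
  define h where "h i = G (1, real i, 1)" for i :: nat
  have base: "(1, real i, 1) \<in> strips b" for i :: nat
    using stripsI[of 1 "real i" 1 b] by simp
  define D where "D = real B ^ 2 + 1 + real (2 * B + b)"
  obtain CD where CD: "CD \<ge> 1"
    "\<And>y y'. y \<in> strips b \<Longrightarrow> y' \<in> strips b \<Longrightarrow> dist y y' \<le> D \<Longrightarrow> dist (G y) (G y') \<le> CD"
    using G(2) by (rule bornologous_onE[where t = D]) blast
  obtain CG where CG: "CG \<ge> 1"
    "\<And>y y'. y \<in> strips b \<Longrightarrow> y' \<in> strips b \<Longrightarrow> dist y y' \<le> 1 \<Longrightarrow> dist (G y) (G y') \<le> CG"
    using G(2) by (rule bornologous_onE[where t = 1]) blast
  have h_dist: "dist (h i) (h 0) \<le> CG * real i" for i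
  proof -
    have "dist (h (Suc r)) (h r) \<le> CG" for r
      unfolding h_def by (intro CG base) (simp add: dist_Pair_Pair dist_real_def)
    then show ?thesis using dist_chain_le[of h CG 0 i] by simp
  qed
  define \<alpha> where "\<alpha> = C1 + CD + dist (h 0) (x 0)"
  have lower: "real r \<le> \<alpha> + CG * s r" for r
  proof -
    define i where "i = nat \<lfloor>s r\<rfloor>"
    have i: "real i \<le> s r" "s r < real i + 1" using s[of r] by (auto simp: i_def)
    have "dist (F (x r)) (1, real i, 1) \<le> D"
    proof -
      have 1: "1 \<le> (real (m r))\<^sup>2" using m[of r] by simp
      have 2: "(real (m r))\<^sup>2 \<le> (real B)\<^sup>2" using m_le[of r] by simp
      have 3: "1 \<le> real (\<kappa> r)" "real (\<kappa> r) \<le> real (2 * B + b)"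
        using \<kappa>(1)[of r] \<kappa>_le[of r] by linarith+
      show ?thesis
        using dist_le_sum_coord[of "(real (m r))\<^sup>2" "s r" "real (\<kappa> r)" 1 "real i" 1] 1 2 3 i
        unfolding Fx D_def by linarith
    qed
    then have 1: "dist (G (F (x r))) (h i) \<le> CD"
      unfolding h_def using F(1) x base by (intro CD) auto
    have 2: "dist (h i) (h 0) \<le> CG * s r"
      using h_dist[of i] mult_left_mono[OF i(1), of CG] CG(1) by linarith
    have 3: "dist (x r) (G (F (x r))) \<le> C1" using GF x by (simp add: dist_commute)
    have "real r \<le> dist (x r) (x 0)"
      using abs_coord_le_dist(2)[of "x r" "x 0"] by (simp add: x_def)
    also have "\<dots> \<le> dist (x r) (G (F (x r))) + dist (G (F (x r))) (h i)
        + dist (h i) (h 0) + dist (h 0) (x 0)"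
      by (smt (verit) dist_triangle)
    finally show ?thesis using 1 2 3 unfolding \<alpha>_def by linarith
  qed

  define C where "C = max CF C2"
  have "\<exists>R. \<forall>r\<ge>R. \<kappa> r = k"
  proof (rule asymptotic_multiplier)
    show "\<bar>s (Suc r) - s r\<bar> \<le> C" for r
      using abs_coord_le_dist(2)[of "F (x (Suc r))" "F (x r)"] Fstep[of r]
      by (simp add: Fx C_def)
    show "\<bar>s (k * r) - real (\<kappa> r) * s r\<bar> \<le> C" for r
    proof -
      have "fibre_scaling (x r) = x (k * r)" by (simp add: x_def)
      then have "dist (F (x (k * r))) (fibre_scaling (F (x r))) \<le> C2" using conj x by metis
      then show ?thesis
        using abs_coord_le_dist(2)[of "F (x (k * r))" "fibre_scaling (F (x r))"]
        by (simp add: Fx C_def)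
    qed
  qed (use lower CG(1) \<kappa>(1) \<kappa>_le nk in auto)
  then obtain R1 where R1: "\<And>r. r \<ge> R1 \<Longrightarrow> \<kappa> r = k" by blast
  obtain R2 :: nat where R2: "\<alpha> + CG * S \<le> real R2" using real_arch_simple by blast
  have "s r \<ge> S" if "r \<ge> R2" for r
  proof -
    have "CG * S \<le> CG * s r" using R2 lower[of r] that by linarith
    then show ?thesis using CG(1) by simp
  qed
  then have "\<forall>r\<ge>max R1 R2. \<exists>m s. F ((real n)\<^sup>2, real r, real k) = ((real m)\<^sup>2, s, real k) \<and>
           m \<ge> 1 \<and> s \<ge> S \<and> s \<ge> 0 \<and> k \<le> 2 * m + b"
    using Fx R1 m s \<kappa>(2) unfolding x_def by (metis max.bounded_iff)
  then show ?thesis by blast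
qed

lemma no_coarse_conjugacy_strips:
  assumes F: "F \<in> strips 1 \<rightarrow> strips 0" "bornologous_on (strips 1) F"
    and G: "G \<in> strips 0 \<rightarrow> strips 1" "bornologous_on (strips 0) G"
    and GF: "\<forall>x\<in>strips 1. dist (G (F x)) x \<le> C1"
    and FG: "\<forall>y\<in>strips 0. dist (F (G y)) y \<le> C2"
    and conjF: "\<forall>x\<in>strips 1. dist (F (fibre_scaling x)) (fibre_scaling (F x)) \<le> C3"
    and conjG: "\<forall>y\<in>strips 0. dist (G (fibre_scaling y)) (fibre_scaling (G y)) \<le> C4"
  shows False
proof -
  obtain CF where CF: "CF \<ge> 1"
    "\<And>x x'. x \<in> strips 1 \<Longrightarrow> x' \<in> strips 1 \<Longrightarrow> dist x x' \<le> 1 \<Longrightarrow> dist (F x) (F x') \<le> CF"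
    using F(2) by (rule bornologous_onE[where t = 1]) blast
  obtain CG where CG: "CG \<ge> 1"
    "\<And>y y'. y \<in> strips 0 \<Longrightarrow> y' \<in> strips 0 \<Longrightarrow> dist y y' \<le> 1 \<Longrightarrow> dist (G y) (G y') \<le> CG"
    using G(2) by (rule bornologous_onE[where t = 1]) blast
  obtain n :: nat where "real n > max CF (max CG C1)" using reals_Archimedean2 by blast
  then have n: "CF < real n" "CG < real n" "C1 < real n" and n1: "n \<ge> 1"
    using CF(1) by auto
  define x where "x r = ((real n)\<^sup>2, real r, real (2 * n + 1))" for r :: nat
  have x: "x r \<in> strips 1" for r unfolding x_def using n1 by (intro stripsI) auto
  have F_ray: "\<exists>R. \<forall>r\<ge>R. \<exists>m s. F (x r) = ((real m)\<^sup>2, s, real (2 * n + 1)) \<and>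
           m \<ge> 1 \<and> s \<ge> S \<and> s \<ge> 0 \<and> 2 * n + 1 \<le> 2 * m + 0" for S
    unfolding x_def by (rule eventually_same_height[OF F G GF conjF]) (use n1 in auto)

  obtain R0 where "\<forall>r\<ge>R0. \<exists>m s. F (x r) = ((real m)\<^sup>2, s, real (2 * n + 1)) \<and>
           m \<ge> 1 \<and> s \<ge> 0 \<and> s \<ge> 0 \<and> 2 * n + 1 \<le> 2 * m + 0"
    using F_ray[of 0] by blast
  then obtain m s0 where "F (x R0) = ((real m)\<^sup>2, s0, real (2 * n + 1))" "2 * n + 1 \<le> 2 * m + 0"
    by blast
  then have m: "fst (F (x R0)) = (real m)\<^sup>2" "n < m" by auto
  have fst_F: "fst (F (x r)) = (real m)\<^sup>2" if "r \<ge> R0" for r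
    using that
  proof (induction r rule: dec_induct)
    case base
    show ?case by (fact m(1))
  next
    case (step r)
    have "dist (F (x (Suc r))) (F (x r)) \<le> CF"
      by (intro CF x) (simp add: x_def dist_Pair_Pair dist_real_def)
    then have "\<bar>fst (F (x (Suc r))) - (real m)\<^sup>2\<bar> \<le> CF"
      using abs_coord_le_dist(1)[of "F (x (Suc r))" "F (x r)"] step.IH by simp
    then show ?case by (rule strip_isolated[rotated]) (use F(1) x n(1) m(2) in auto)
  qed

  \<comment> \<open>\<open>G\<close> sends far points on the top ray of component \<open>m\<close> into components \<open>\<nu> \<ge> m\<close>.\<close>
  have "\<exists>R. \<forall>r\<ge>R. \<exists>\<nu> s. G ((real m)\<^sup>2, real r, real (2 * m)) = ((real \<nu>)\<^sup>2, s, real (2 * m)) \<and>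
           \<nu> \<ge> 1 \<and> s \<ge> 0 \<and> s \<ge> 0 \<and> 2 * m \<le> 2 * \<nu> + 1"
    by (rule eventually_same_height[OF G F FG conjG]) (use m(2) in auto)
  then obtain R1 where R1: "\<And>r. r \<ge> R1 \<Longrightarrow>
      \<exists>\<nu> s. G ((real m)\<^sup>2, real r, real (2 * m)) = ((real \<nu>)\<^sup>2, s, real (2 * m)) \<and> 2 * m \<le> 2 * \<nu> + 1"
    by blast
  obtain R2 where R2: "\<And>r. r \<ge> R2 \<Longrightarrow>
      \<exists>m s. F (x r) = ((real m)\<^sup>2, s, real (2 * n + 1)) \<and> s \<ge> real R1 + 1"
    using F_ray[of "real R1 + 1"] by blast

  \<comment> \<open>Starting at \<open>F (x r)\<close>, which \<open>G\<close> maps near \<open>x r\<close>, unit steps inside component \<open>m\<close> lead to that top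
    ray, while the image under \<open>G\<close> cannot leave component \<open>n\<close>.\<close>
  define r where "r = max R0 R2"
  obtain s where Fxr: "F (x r) = ((real m)\<^sup>2, s, real (2 * n + 1))" and s: "s \<ge> real R1 + 1"
    using R2[of r] fst_F[of r] by (auto simp: r_def)
  define i where "i = nat \<lfloor>s\<rfloor>"
  have i: "real i \<le> s" "s < real i + 1" using s by (auto simp: i_def)
  have iR1: "i \<ge> R1" using i s by linarith
  have y: "((real m)\<^sup>2, real i, real l) \<in> strips 0" if "l \<ge> 1" "l \<le> 2 * m" for l
    using that m(2) by (intro stripsI) auto
  have GF_xr: "fst (G (F (x r))) = (real n)\<^sup>2"
  proof (rule strip_isolated)
    show "G (F (x r)) \<in> strips 1" using F(1) G(1) x by blast
    show "\<bar>fst (G (F (x r))) - (real n)\<^sup>2\<bar> \<le> C1"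
      using abs_coord_le_dist(1)[of "G (F (x r))" "x r"] GF x[of r] by (fastforce simp: x_def)
  qed (fact n(3))
  have stay: "fst (G y') = (real n)\<^sup>2"
    if "y \<in> strips 0" "y' \<in> strips 0" "dist y' y \<le> 1" "fst (G y) = (real n)\<^sup>2" for y y'
  proof (rule strip_isolated)
    show "G y' \<in> strips 1" using G(1) that by blast
    show "\<bar>fst (G y') - (real n)\<^sup>2\<bar> \<le> CG"
      using abs_coord_le_dist(1)[of "G y'" "G y"] CG(2)[of y' y] that by simp
  qed (fact n(2))
  have "fst (G ((real m)\<^sup>2, real i, real l)) = (real n)\<^sup>2" if "2 * n + 1 \<le> l" "l \<le> 2 * m" for l
    using that
  proof (induction l rule: dec_induct)
    case base
    show ?case
    proof (rule stay[OF _ y _ GF_xr])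
      show "F (x r) \<in> strips 0" using F(1) x by blast
      show "dist ((real m)\<^sup>2, real i, real (2 * n + 1)) (F (x r)) \<le> 1"
        using i unfolding Fxr by (simp add: dist_Pair_Pair dist_real_def)
    qed (use m(2) in auto)
  next
    case (step l)
    show ?case
      by (rule stay[OF y[of l] y]) (use step in \<open>auto simp: dist_Pair_Pair dist_real_def\<close>)
  qed
  then have "fst (G ((real m)\<^sup>2, real i, real (2 * m))) = (real n)\<^sup>2" using m(2)
    by (simp del: of_nat_mult)
  then show False using R1[OF iR1] m(2) by auto
qed

section \<open>The two systems\<close>

theorem theorem3p3:
  fixes N :: "real \<times> real \<times> real \<Rightarrow> real"
    and f g \<phi> \<psi> :: "real \<times> real \<times> real \<Rightarrow> real \<times> real \<times> real"
  defines "X \<equiv> norm_metric_on N X_set"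
    and "Y \<equiv> norm_metric_on N Y_set"
  assumes N: "is_norm N"
    and f: "\<And>(n::nat) (r::real) (k::nat). n \<ge> 1 \<Longrightarrow> r \<ge> 0 \<Longrightarrow> k \<in> {1..2 * n + 1} \<Longrightarrow>
              f ((real n)\<^sup>2, r, real k) = ((real n)\<^sup>2, real k * r, real k)"
    and g: "\<And>y. y \<in> Y_set \<Longrightarrow> g y = f y"
    and \<phi>: "\<And>(n::nat) (r::real) (k::nat). n \<ge> 1 \<Longrightarrow> r \<ge> 0 \<Longrightarrow> k \<in> {1..2 * n + 1} \<Longrightarrow>
              \<phi> ((real n)\<^sup>2, r, real k) = ((real n + 1)\<^sup>2, r, real k)"
    and \<psi>: "\<And>(n::nat) (r::real) (k::nat). n \<ge> 1 \<Longrightarrow> r \<ge> 0 \<Longrightarrow> k \<in> {1..2 * n} \<Longrightarrow>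
              \<psi> ((real n)\<^sup>2, r, real k) = ((real n)\<^sup>2, r, real k)"
  shows "bij_betw f X_set X_set \<and> Y_set \<subseteq> X_set \<and> g \<in> Y_set \<rightarrow> Y_set \<and>
         coarse_equivalence X Y \<phi> \<and> coarse_equivalence Y X \<psi> \<and>
         close Y X_set (\<phi> \<circ> f) (g \<circ> \<phi>) \<and>
         close X Y_set (\<psi> \<circ> g) (f \<circ> \<psi>) \<and>
         \<not> coarsely_conjugate X Y f g"
proof (intro conjI)
  have X: "X = norm_metric_on N (strips 1)" and Y: "Y = norm_metric_on N (strips 0)"
    by (simp_all add: X_def Y_def X_set_eq_strips Y_set_eq_strips)
  have mspace: "mspace X = strips 1" "mspace Y = strips 0"
    by (simp_all add: X Y mspace_norm_metric_on[OF N])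
  have close_X: "close X S u v \<longleftrightarrow> (\<exists>C. \<forall>x\<in>S. dist (u x) (v x) \<le> C)"
    and close_Y: "close Y S u v \<longleftrightarrow> (\<exists>C. \<forall>x\<in>S. dist (u x) (v x) \<le> C)"
    for S :: "(real \<times> real \<times> real) set" and u v
    unfolding X Y by (rule close_norm_metric_iff[OF N])+
  show YX: "Y_set \<subseteq> X_set"
    unfolding X_set_eq_strips Y_set_eq_strips by (auto elim!: stripsE intro!: stripsI)
  have f_scaling: "f x = fibre_scaling x" if "x \<in> strips 1" for x
    using that by (elim stripsE) (simp add: f)
  have g_scaling: "g y = fibre_scaling y" if "y \<in> strips 0" for y
    using that g[of y] f_scaling[of y] YX unfolding X_set_eq_strips Y_set_eq_strips by (metis subsetD)
  have scaling_mem: "fibre_scaling x \<in> strips e" if "x \<in> strips e" for x e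
    using that by (elim stripsE) (auto intro!: stripsI)
  have \<phi>': "\<phi> ((real n)\<^sup>2, r, real k) = ((real (n + 1))\<^sup>2, r, real k)"
    if "n \<ge> 1" "r \<ge> 0" "k \<ge> 1" "k \<le> 2 * n + 1" for n r k
    using \<phi> that by (simp add: add.commute)
  have \<psi>': "\<psi> ((real n)\<^sup>2, r, real k) = ((real n)\<^sup>2, r, real k)"
    if "n \<ge> 1" "r \<ge> 0" "k \<ge> 1" "k \<le> 2 * n + 0" for n r k
    using \<psi> that by simp

  show "g \<in> Y_set \<rightarrow> Y_set"
    using g_scaling scaling_mem unfolding Y_set_eq_strips by auto

  show "bij_betw f X_set X_set"
    unfolding X_set_eq_strips
  proof (rule bij_betw_byWitness[where f' = "\<lambda>(p, r, k). (p, r / k, k)"])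
    show "\<forall>x\<in>strips 1. (\<lambda>(p, r, k). (p, r / k, k)) (f x) = x"
      by (auto elim!: stripsE simp: f)
    show "\<forall>x\<in>strips 1. f ((\<lambda>(p, r, k). (p, r / k, k)) x) = x"
      by (auto elim!: stripsE simp: f)
    show "f ` strips 1 \<subseteq> strips 1" using f_scaling scaling_mem by auto
    show "(\<lambda>(p, r, k). (p, r / k, k)) ` strips 1 \<subseteq> strips 1"
      by (auto elim!: stripsE intro!: stripsI)
  qed

  have controlled_\<phi>: "controlled X Y \<phi>"
    unfolding X Y by (rule controlled_strips[OF N \<phi>']) auto
  have controlled_\<psi>: "controlled Y X \<psi>"
    unfolding X Y by (rule controlled_strips[OF N \<psi>']) auto

  define \<psi>inv where "\<psi>inv = strip_map (\<lambda>n. n) (\<lambda>n k. min k (2 * n))"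
  have "controlled X Y \<psi>inv"
    unfolding X Y by (rule controlled_strips[OF N, where \<mu> = "\<lambda>n. n" and \<kappa> = "\<lambda>n k. min k (2 * n)"])
      (auto simp: \<psi>inv_def min_def abs_if)
  moreover have "dist (\<psi> (\<psi>inv x)) x \<le> 1" if x: "x \<in> strips 1" for x
  proof -
    obtain n r k where n: "x = ((real n)\<^sup>2, r, real k)" "n \<ge> 1" "r \<ge> 0" "k \<ge> 1" "k \<le> 2 * n + 1"
      using x by (rule stripsE)
    have "\<psi> (\<psi>inv x) = ((real n)\<^sup>2, r, real (min k (2 * n)))"
      unfolding n(1) \<psi>inv_def strip_map_simp by (rule \<psi>') (use n in auto)
    moreover have "\<bar>real (min k (2 * n)) - real k\<bar> \<le> 1" using n by linarith
    ultimately show ?thesis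
      using dist_le_sum_coord[of "(real n)\<^sup>2" r "real (min k (2 * n))" "(real n)\<^sup>2" r "real k"]
      unfolding n(1) by simp
  qed
  moreover have "dist (\<psi>inv (\<psi> y)) y \<le> 1" if "y \<in> strips 0" for y
    using that by (elim stripsE) (auto simp: \<psi>inv_def \<psi>')
  ultimately show "coarse_equivalence Y X \<psi>"
    unfolding coarse_equivalence_def coarse_inverse_def mspace close_X close_Y
      comp_apply id_apply
    using controlled_\<psi> by blast

  \<comment> \<open>Component \<open>1\<close> has no predecessor and is sent to itself; this displaces it by \<open>2\<^sup>2 - 1\<^sup>2 = 3\<close>
    under \<open>\<phi> \<circ> \<phi>inv\<close>.\<close>
  define \<phi>inv where "\<phi>inv = strip_map (\<lambda>n. max 1 (n - 1)) (\<lambda>n k. min k (2 * max 1 (n - 1) + 1))"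
  have "controlled Y X \<phi>inv"
    unfolding X Y
    by (rule controlled_strips[OF N, where \<mu> = "\<lambda>n. max 1 (n - 1)"
        and \<kappa> = "\<lambda>n k. min k (2 * max 1 (n - 1) + 1)"]) 
      (auto simp: \<phi>inv_def min_def max_def abs_if)
  moreover have "dist (\<phi> (\<phi>inv y)) y \<le> 4" if y: "y \<in> strips 0" for y
  proof -
    obtain n r k where n: "y = ((real n)\<^sup>2, r, real k)" "n \<ge> 1" "r \<ge> 0" "k \<ge> 1" "k \<le> 2 * n + 0"
      using y by (rule stripsE)
    define m where "m = max 1 (n - 1)"
    have "\<phi> (\<phi>inv y) = ((real (m + 1))\<^sup>2, r, real (min k (2 * m + 1)))"
      unfolding n(1) \<phi>inv_def strip_map_simp m_def[symmetric]
      by (rule \<phi>') (use n in \<open>auto simp: m_def\<close>)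
    moreover have "\<bar>(real (m + 1))\<^sup>2 - (real n)\<^sup>2\<bar> \<le> 3"
      using n(2) by (cases "n = 1") (auto simp: m_def max_def)
    moreover have "\<bar>real (min k (2 * m + 1)) - real k\<bar> \<le> 1"
      using n by (auto simp: m_def max_def min_def)
    ultimately show ?thesis
      using dist_le_sum_coord[of "(real (m + 1))\<^sup>2" r "real (min k (2 * m + 1))" "(real n)\<^sup>2" r "real k"]
      unfolding n(1) by simp
  qed
  moreover have "dist (\<phi>inv (\<phi> x)) x \<le> 4" if "x \<in> strips 1" for x
    using that by (elim stripsE) (simp add: \<phi>inv_def \<phi>' del: of_nat_add of_nat_Suc)
  ultimately show "coarse_equivalence X Y \<phi>"
    unfolding coarse_equivalence_def coarse_inverse_def mspace close_X close_Y
      comp_apply id_apply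
    using controlled_\<phi> by blast

  have "\<phi> (f x) = g (\<phi> x)" if x: "x \<in> strips 1" for x
  proof -
    obtain n r k where n: "x = ((real n)\<^sup>2, r, real k)" "n \<ge> 1" "r \<ge> 0" "k \<ge> 1" "k \<le> 2 * n + 1"
      using x by (rule stripsE)
    have "\<phi> x \<in> strips 0" using controlled_\<phi> x by (auto simp: controlled_def mspace)
    then have "g (\<phi> x) = fibre_scaling (\<phi> x)" by (rule g_scaling)
    then show ?thesis using n by (simp add: f \<phi>')
  qed
  then show "close Y X_set (\<phi> \<circ> f) (g \<circ> \<phi>)"
    unfolding close_Y X_set_eq_strips by auto
  have "\<psi> (g y) = f (\<psi> y)" if y: "y \<in> strips 0" for y
    using g_scaling[OF y] y by (elim stripsE) (auto simp: f \<psi>')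
  then show "close X Y_set (\<psi> \<circ> g) (f \<circ> \<psi>)"
    unfolding close_X Y_set_eq_strips by auto

  show "\<not> coarsely_conjugate X Y f g"
  proof
    assume "coarsely_conjugate X Y f g"
    then obtain F G where F: "controlled X Y F" and G: "controlled Y X G"
      and FG: "close Y (strips 0) (F \<circ> G) id" and GF: "close X (strips 1) (G \<circ> F) id"
      and conjF: "close Y (strips 1) (F \<circ> f) (g \<circ> F)"
      and conjG: "close X (strips 0) (G \<circ> g) (f \<circ> G)"
      unfolding coarsely_conjugate_def coarse_equivalence_def coarse_inverse_def mspace by blast
    have F': "F \<in> strips 1 \<rightarrow> strips 0" "bornologous_on (strips 1) F"
      and G': "G \<in> strips 0 \<rightarrow> strips 1" "bornologous_on (strips 0) G"
      using F G controlled_norm_metricD[OF N] unfolding X Y by blast+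
    obtain C1 where C1: "\<forall>x\<in>strips 1. dist (G (F x)) x \<le> C1" using GF by (auto simp: close_X)
    obtain C2 where C2: "\<forall>y\<in>strips 0. dist (F (G y)) y \<le> C2" using FG by (auto simp: close_Y)
    obtain C3 where "\<forall>x\<in>strips 1. dist (F (f x)) (g (F x)) \<le> C3" using conjF by (auto simp: close_Y)
    then have C3: "\<forall>x\<in>strips 1. dist (F (fibre_scaling x)) (fibre_scaling (F x)) \<le> C3"
      using F'(1) f_scaling g_scaling by (metis PiE)
    obtain C4 where "\<forall>y\<in>strips 0. dist (G (g y)) (f (G y)) \<le> C4" using conjG by (auto simp: close_X)
    then have C4: "\<forall>y\<in>strips 0. dist (G (fibre_scaling y)) (fibre_scaling (G y)) \<le> C4"
      using G'(1) f_scaling g_scaling by (metis PiE)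
    show False by (rule no_coarse_conjugacy_strips[OF F' G' C1 C2 C3 C4])
  qed
qed

end
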